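(* Let $\boldsymbol{A}\in\mathbb{R}^{n\times n}$ be invertible, let $\boldsymbol{b}\in\mathbb{R}^n$, and let $\boldsymbol{x}=\boldsymbol{A}^{-1}\boldsymbol{b}$. Suppose that iterative refinement, executed in floating-point arithmetic with unit roundoff $u$, is performed $t=\log_2\!\left(\frac{1}{\tilde\kappa(\boldsymbol{A})u}\right)$ times (rounded up to an integer), where each refinement (as well as the initial solve) executes a suitable number $\mathcal{O}(\tilde\kappa(\boldsymbol{A})^2)$ of iterations of randomized Kaczmarz. If $\tilde\kappa(\boldsymbol{A})^2u\ll 1$, then the computed output $\widehat{\boldsymbol{x}}_t$ of this scheme satisfies $$\mathbb{E}\,\|\widehat{\boldsymbol{x}}_t-\boldsymbol{x}\|\lesssim\|\boldsymbol{x}\|\,\tilde\kappa(\boldsymbol{A})u.$$ (The constant implied by $\mathcal{O}$ is absolute, and the polynomials in $n$ implied by $\ll$ and $\lesssim$ are universal.)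
   Context: Norms: $\|\cdot\|$ is the vector $\ell_2$ norm and its induced operator norm; $\|\cdot\|_{\rm F}$ is the Frobenius norm. The Demmel condition number is $\tilde\kappa(\boldsymbol{A})=\|\boldsymbol{A}\|_{\rm F}\|\boldsymbol{A}^{-1}\|$. Asymptotic notation: $a\lesssim b$ means $a\le C(n)b$ for a fixed universal (unspecified) polynomial $C(n)>0$; $a\ll b$ means $a\le b/C(n)$ for a sufficiently large universal polynomial $C(n)>0$. Randomized Kaczmarz for a system $\boldsymbol{A}\boldsymbol{z}=\boldsymbol{c}$: with $\boldsymbol{a}_i^\top$ the $i$th row of $\boldsymbol{A}$, iteration $k=0,1,\dots$ draws (independently of the past) an index $r(k)$ with $\Pr[r(k)=i]=\|\boldsymbol{a}_i\|^2/\|\boldsymbol{A}\|_{\rm F}^2$ and sets $$\boldsymbol{z}_{k+1}=\boldsymbol{z}_k+\frac{c_{r(k)}-\langle\boldsymbol{a}_{r(k)},\boldsymbol{z}_k\rangle}{\langle\boldsymbol{a}_{r(k)},\boldsymbol{a}_{r(k)}\rangle}\boldsymbol{a}_{r(k)}.$$ Iterative refinement: let $\mathrm{Solver}(\boldsymbol{c})$ denote the floating-point output of the prescribed number of randomized Kaczmarz iterations on $\boldsymbol{A}\boldsymbol{z}=\boldsymbol{c}$ started at $\boldsymbol{z}_0=\boldsymbol{0}$ with fresh independent randomness. The scheme computes $\boldsymbol{x}_0:=\mathrm{Solver}(\boldsymbol{b})$ and $\boldsymbol{x}_{i+1}:=\boldsymbol{x}_i+\mathrm{Solver}(\boldsymbol{b}-\boldsymbol{A}\boldsymbol{x}_i)$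 for $i=0,\dots,t-1$, with all operations (including residual computation) in floating-point arithmetic of the same precision $u$. $\widehat{\boldsymbol{x}}_t$ is the computed value of $\boldsymbol{x}_t$. The expectation is over all random row indices. Floating-point model (standard model, unit roundoff $u$, no overflow/underflow): the rounding function $\mathrm{fl}$ satisfies $|\mathrm{fl}(x)-x|\le u|x|$ for all $x\in\mathbb{R}$, and for exactly represented scalars $a,b$ and $\mathrm{op}\in\{+,-,\times,\div\}$ the computed value of $a\,\mathrm{op}\,b$ differs from $a\,\mathrm{op}\,b$ by at most $u\,|a\,\mathrm{op}\,b|$. Vector operations, inner products and matrix–vector products are computed by the standard routines from these scalar operations, and expressions are evaluated in the natural way. The entries of $\boldsymbol{A}$ and $\boldsymbol{b}$ are exactly represented, and row indices are sampled with the stated probabilities. *)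

theory Defs
  imports
    "HOL-Probability.Probability_Mass_Function"
    "Jordan_Normal_Form.Gauss_Jordan_Elimination"
begin

unbundle no vec_syntax
unbundle no inner_syntax

text \<open>
  The dimension \<open>n\<close> is quantified inside the theorem (after the universal polynomials), so vectors
  and matrices are those of \<^theory>\<open>Jordan_Normal_Form.Matrix\<close>, with indices \<open>0, \<dots>, n - 1\<close>.
\<close>

subsection \<open>Norms and the Demmel condition number\<close>

definition l2_norm :: "real vec \<Rightarrow> real" where
  "l2_norm v = L2_set (\<lambda>i. v $ i) {..<dim_vec v}"

definition frobenius_norm :: "real mat \<Rightarrow> real" where
  "frobenius_norm A = L2_set (\<lambda>ij. A $$ ij) ({..<dim_row A} \<times> {..<dim_col A})"

text \<open>As for \<^const>\<open>onorm\<close>, the zero vector contributes the quotient \<open>0 / 0 = 0\<close>.\<close>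

definition op_norm :: "real mat \<Rightarrow> real" where
  "op_norm A = (SUP v\<in>carrier_vec (dim_col A). l2_norm (A *\<^sub>v v) / l2_norm v)"

definition inverse_mat :: "real mat \<Rightarrow> real mat" where
  "inverse_mat A = the (mat_inverse A)"

lemma inverse_mat:
  assumes A: "A \<in> carrier_mat n n" and inv: "invertible_mat A"
  shows "inverse_mat A \<in> carrier_mat n n" "A * inverse_mat A = 1\<^sub>m n" "inverse_mat A * A = 1\<^sub>m n"
proof -
  obtain B where AB: "A * B = 1\<^sub>m (dim_row A)" and BA: "B * A = 1\<^sub>m (dim_row B)"
    using inv unfolding invertible_mat_def inverts_mat_def by blast
  have "dim_row B = n"
    using arg_cong[OF BA, of dim_col] A by simp
  moreover have "dim_col B = n"
    using arg_cong[OF AB, of dim_col] A by simp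
  ultimately have "A \<in> Units (ring_mat TYPE(real) n ())"
    using A AB BA by (auto simp: Units_def ring_mat_def intro!: bexI[of _ B])
  then obtain C where "mat_inverse A = Some C"
    using mat_inverse(1)[OF A, of "()"] by (cases "mat_inverse A") auto
  with mat_inverse(2)[OF A this]
  show "inverse_mat A \<in> carrier_mat n n" "A * inverse_mat A = 1\<^sub>m n" "inverse_mat A * A = 1\<^sub>m n"
    by (auto simp: inverse_mat_def)
qed

definition demmel_cond :: "real mat \<Rightarrow> real" where
  "demmel_cond A = frobenius_norm A * op_norm (inverse_mat A)"

subsection \<open>Floating-point arithmetic\<close>

record fp_arith =
  fp_round :: "real \<Rightarrow> real"
  fp_add :: "real \<Rightarrow> real \<Rightarrow> real"
  fp_sub :: "real \<Rightarrow> real \<Rightarrow> real"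
  fp_mul :: "real \<Rightarrow> real \<Rightarrow> real"
  fp_div :: "real \<Rightarrow> real \<Rightarrow> real"

text \<open>The exactly represented scalars are the fixed points of rounding.\<close>

definition exactly_rep :: "fp_arith \<Rightarrow> real \<Rightarrow> bool" where
  "exactly_rep F a \<longleftrightarrow> fp_round F a = a"

text \<open>
  The results of the operations must be represented again, since they are operands of later
  operations. They are not required to be the rounded exact results.
\<close>

definition fp_op_accurate ::
    "fp_arith \<Rightarrow> real \<Rightarrow> (real \<Rightarrow> real \<Rightarrow> real) \<Rightarrow> (real \<Rightarrow> real \<Rightarrow> real) \<Rightarrow> real \<Rightarrow> real \<Rightarrow> bool" where
  "fp_op_accurate F u cop op a b \<longleftrightarrow>
     exactly_rep F (cop a b) \<and> \<bar>cop a b - op a b\<bar> \<le> u * \<bar>op a b\<bar>"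

definition standard_model :: "real \<Rightarrow> fp_arith \<Rightarrow> bool" where
  "standard_model u F \<longleftrightarrow>
     (\<forall>x. \<bar>fp_round F x - x\<bar> \<le> u * \<bar>x\<bar>) \<and>
     (\<forall>a b. exactly_rep F a \<longrightarrow> exactly_rep F b \<longrightarrow>
        fp_op_accurate F u (fp_add F) (+) a b \<and>
        fp_op_accurate F u (fp_sub F) (-) a b \<and>
        fp_op_accurate F u (fp_mul F) (*) a b \<and>
        (b \<noteq> 0 \<longrightarrow> fp_op_accurate F u (fp_div F) (/) a b))"

text \<open>Recursive summation from left to right; the sum of one term is that term, without rounding.\<close>

fun fp_sum_list :: "fp_arith \<Rightarrow> real list \<Rightarrow> real" where
  "fp_sum_list F [] = 0"
| "fp_sum_list F (x # xs) = foldl (fp_add F) x xs"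

definition fp_inner :: "fp_arith \<Rightarrow> real vec \<Rightarrow> real vec \<Rightarrow> real" where
  "fp_inner F v w = fp_sum_list F (map (\<lambda>i. fp_mul F (v $ i) (w $ i)) [0..<dim_vec w])"

definition fp_vec_add :: "fp_arith \<Rightarrow> real vec \<Rightarrow> real vec \<Rightarrow> real vec" where
  "fp_vec_add F v w = vec (dim_vec w) (\<lambda>i. fp_add F (v $ i) (w $ i))"

definition fp_vec_sub :: "fp_arith \<Rightarrow> real vec \<Rightarrow> real vec \<Rightarrow> real vec" where
  "fp_vec_sub F v w = vec (dim_vec w) (\<lambda>i. fp_sub F (v $ i) (w $ i))"

definition fp_smult_vec :: "fp_arith \<Rightarrow> real \<Rightarrow> real vec \<Rightarrow> real vec" where
  "fp_smult_vec F \<alpha> v = vec (dim_vec v) (\<lambda>i. fp_mul F \<alpha> (v $ i))"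

definition fp_mult_mat_vec :: "fp_arith \<Rightarrow> real mat \<Rightarrow> real vec \<Rightarrow> real vec" where
  "fp_mult_mat_vec F A v = vec (dim_row A) (\<lambda>i. fp_inner F (row A i) v)"

subsection \<open>Randomized Kaczmarz\<close>

definition row_pmf :: "real mat \<Rightarrow> nat pmf" where
  "row_pmf A = embed_pmf
     (\<lambda>i. if i < dim_row A then (l2_norm (row A i))\<^sup>2 / (frobenius_norm A)\<^sup>2 else 0)"

lemma frobenius_norm_eq_sum_rows:
  "(frobenius_norm A)\<^sup>2 = (\<Sum>i<dim_row A. (l2_norm (row A i))\<^sup>2)"
  by (simp add: frobenius_norm_def l2_norm_def L2_set_def sum_nonneg sum.cartesian_product
      split_def)

lemma pmf_row_pmf:
  assumes "frobenius_norm A \<noteq> 0"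
  shows "pmf (row_pmf A) i =
    (if i < dim_row A then (l2_norm (row A i))\<^sup>2 / (frobenius_norm A)\<^sup>2 else 0)"
  unfolding row_pmf_def
proof (rule pmf_embed_pmf)
  let ?f = "\<lambda>i. if i < dim_row A then (l2_norm (row A i))\<^sup>2 / (frobenius_norm A)\<^sup>2 else 0"
  have "(\<integral>\<^sup>+ i. ennreal (?f i) \<partial>count_space UNIV) = (\<Sum>i<dim_row A. ennreal (?f i))"
    by (rule nn_integral_count_space') auto
  also have "\<dots> = ennreal (\<Sum>i<dim_row A. ?f i)"
    by (rule sum_ennreal) auto
  also have "(\<Sum>i<dim_row A. ?f i) = 1"
    using assms by (simp add: sum_divide_distrib[symmetric] frobenius_norm_eq_sum_rows[symmetric])
  finally show "(\<integral>\<^sup>+ i. ennreal (?f i) \<partial>count_space UNIV) = 1" by simp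
qed auto

definition fp_kaczmarz_step ::
    "fp_arith \<Rightarrow> real mat \<Rightarrow> real vec \<Rightarrow> nat \<Rightarrow> real vec \<Rightarrow> real vec" where
  "fp_kaczmarz_step F A c r z =
     fp_vec_add F z
       (fp_smult_vec F
         (fp_div F (fp_sub F (c $ r) (fp_inner F (row A r) z)) (fp_inner F (row A r) (row A r)))
         (row A r))"

text \<open>
  The distribution of the computed iterate after the given number of iterations on \<open>A z = c\<close>: every
  \<^const>\<open>bind_pmf\<close> draws the row index independently of the past.
\<close>

primrec fp_kaczmarz :: "fp_arith \<Rightarrow> real mat \<Rightarrow> real vec \<Rightarrow> nat \<Rightarrow> real vec pmf" where
  "fp_kaczmarz F A c 0 = return_pmf (0\<^sub>v (dim_col A))"
| "fp_kaczmarz F A c (Suc k) =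
     bind_pmf (fp_kaczmarz F A c k) (\<lambda>z.
     bind_pmf (row_pmf A) (\<lambda>r.
     return_pmf (fp_kaczmarz_step F A c r z)))"

subsection \<open>Iterative refinement\<close>

text \<open>The distribution of the computed \<open>x\<^sub>t\<close>, where each solve runs \<open>K\<close> Kaczmarz iterations.\<close>

primrec fp_refinement ::
    "fp_arith \<Rightarrow> real mat \<Rightarrow> real vec \<Rightarrow> nat \<Rightarrow> nat \<Rightarrow> real vec pmf" where
  "fp_refinement F A b K 0 = fp_kaczmarz F A b K"
| "fp_refinement F A b K (Suc t) =
     bind_pmf (fp_refinement F A b K t) (\<lambda>x.
     bind_pmf (fp_kaczmarz F A (fp_vec_sub F b (fp_mult_mat_vec F A x)) K) (\<lambda>d.
     return_pmf (fp_vec_add F x d)))"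

text \<open>
  Hence an expectation over \<^const>\<open>fp_refinement\<close> is a finite sum, so that it is never the default
  value of a non-integrable function.
\<close>

lemma finite_set_row_pmf: "frobenius_norm A \<noteq> 0 \<Longrightarrow> finite (set_pmf (row_pmf A))"
  by (rule finite_subset[of _ "{..<dim_row A}"]) (auto simp: set_pmf_eq pmf_row_pmf split: if_splits)

lemma finite_set_fp_kaczmarz:
  "frobenius_norm A \<noteq> 0 \<Longrightarrow> finite (set_pmf (fp_kaczmarz F A c k))"
  by (induction k) (auto simp: finite_set_row_pmf)

lemma finite_set_fp_refinement:
  "frobenius_norm A \<noteq> 0 \<Longrightarrow> finite (set_pmf (fp_refinement F A b K t))"
  by (induction t) (auto simp: finite_set_fp_kaczmarz)

end

theory Submission
  imports Defs
begin

text \<open>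
  The expectation of the error norm itself is propagated through the whole computation, since
  rounding errors enter it additively. Write \<open>\<kappa>\<close> for the Demmel condition number.

  \<^item> One exact Kaczmarz step projects the error \<open>e\<close> orthogonally to a random row, and
    in expectation this multiplies \<open>\<parallel>e\<parallel>\<close> by at most \<open>1 - 1 / (2 \<kappa>\<^sup>2)\<close>
    (\<open>expected_projection_l2_norm_le\<close>).
  \<^item> Rounding perturbs the step by at most a multiple of \<open>n u (\<parallel>e\<parallel> + \<parallel>x\<parallel>)\<close>, where \<open>x\<close> is the
    solution: the perturbation is measured by the size of the solution and not by that of the
    right-hand side, because the entry \<open>c\<^sub>r\<close> is at most \<open>\<parallel>a\<^sub>r\<parallel> \<parallel>x\<parallel>\<close>
    (\<open>fp_kaczmarz_step_error\<close>).
  \<^item> Hence, if \<open>n u \<kappa>\<^sup>2\<close> is small, the expected error norm obeys an affine recursion with factor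
    \<open>1 - 1 / (4 \<kappa>\<^sup>2)\<close> and a fixed point of order \<open>n u \<kappa>\<^sup>2 \<parallel>x\<parallel>\<close>. After \<open>12 \<kappa>\<^sup>2\<close> steps the expected
    relative error is at most a quarter (\<open>fp_kaczmarz_expected_error\<close>). A solve is thus only
    required to be right up to a constant factor.
  \<^item> In a refinement step, the solution of the system for the computed residual deviates from the
    true correction by a multiple of \<open>n u \<kappa> (\<parallel>e\<parallel> + \<parallel>x\<parallel>)\<close>: the first power of \<open>\<kappa>\<close>. The step therefore
    halves the expected error up to an additive term of order \<open>n u \<kappa> \<parallel>x\<parallel>\<close>
    (\<open>fp_refinement_step_expected_error\<close>).
  \<^item> After \<open>t\<close> refinements there remain \<open>2\<^sup>-\<^sup>t \<parallel>x\<parallel>\<close>, which the choice of \<open>t\<close> makes at most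
    \<open>\<kappa> u \<parallel>x\<parallel>\<close>, and the accumulated additive terms, which form a geometric series
    (\<open>fp_refinement_expected_error\<close>).
\<close>

section \<open>Euclidean and operator norms\<close>

lemma l2_norm_eq: "v \<in> carrier_vec n \<Longrightarrow> l2_norm v = L2_set (\<lambda>i. v $ i) {..<n}"
  by (auto simp: l2_norm_def)

lemma l2_norm_nonneg [simp]: "0 \<le> l2_norm v"
  by (simp add: l2_norm_def)

lemma frobenius_norm_nonneg [simp]: "0 \<le> frobenius_norm A"
  by (simp add: frobenius_norm_def)

lemma l2_norm_sq: "(l2_norm v)\<^sup>2 = v \<bullet> v"
  by (simp add: l2_norm_def L2_set_def sum_nonneg scalar_prod_def power2_eq_square
      lessThan_atLeast0)

lemma l2_norm_triangle:
  assumes "v \<in> carrier_vec n" "w \<in> carrier_vec n"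
  shows "l2_norm (v + w) \<le> l2_norm v + l2_norm w"
proof -
  have "l2_norm (v + w) = L2_set (\<lambda>i. v $ i + w $ i) {..<n}"
    using assms by (auto simp: l2_norm_def intro!: L2_set_cong)
  also have "\<dots> \<le> l2_norm v + l2_norm w"
    using assms L2_set_triangle_ineq by (simp add: l2_norm_eq)
  finally show ?thesis .
qed

lemma l2_norm_le_scaled:
  assumes "v \<in> carrier_vec n" "w \<in> carrier_vec n" "0 \<le> c"
    and "\<And>i. i < n \<Longrightarrow> \<bar>v $ i\<bar> \<le> c * \<bar>w $ i\<bar>"
  shows "l2_norm v \<le> c * l2_norm w"
proof -
  have "l2_norm v = L2_set (\<lambda>i. \<bar>v $ i\<bar>) {..<n}"
    using assms by (simp add: l2_norm_eq L2_set_def)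
  also have "\<dots> \<le> L2_set (\<lambda>i. c * \<bar>w $ i\<bar>) {..<n}"
    using assms by (intro L2_set_mono) auto
  also have "\<dots> = c * L2_set (\<lambda>i. \<bar>w $ i\<bar>) {..<n}"
    using assms by (simp add: L2_set_right_distrib)
  also have "\<dots> = c * l2_norm w"
    using assms by (simp add: l2_norm_eq L2_set_def)
  finally show ?thesis .
qed

lemma l2_norm_smult: "l2_norm (c \<cdot>\<^sub>v v) = \<bar>c\<bar> * l2_norm v"
proof -
  have "l2_norm (c \<cdot>\<^sub>v v) = L2_set (\<lambda>i. \<bar>c\<bar> * v $ i) {..<dim_vec v}"
    by (simp add: l2_norm_def L2_set_def power_mult_distrib)
  then show ?thesis by (simp add: L2_set_right_distrib l2_norm_def)
qed

lemma l2_norm_uminus: "l2_norm (- v) = l2_norm v"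
  by (simp add: l2_norm_def L2_set_def)

lemma sum_abs_mult_le_l2_norm:
  assumes "v \<in> carrier_vec n" "w \<in> carrier_vec n"
  shows "(\<Sum>i<n. \<bar>v $ i * w $ i\<bar>) \<le> l2_norm v * l2_norm w"
  using L2_set_mult_ineq[of "\<lambda>i. v $ i" "\<lambda>i. w $ i" "{..<n}"] assms
  by (simp add: l2_norm_eq abs_mult)

lemma abs_scalar_prod_le:
  assumes "v \<in> carrier_vec n" "w \<in> carrier_vec n"
  shows "\<bar>v \<bullet> w\<bar> \<le> l2_norm v * l2_norm w"
proof -
  have "\<bar>v \<bullet> w\<bar> \<le> (\<Sum>i<n. \<bar>v $ i * w $ i\<bar>)"
    using assms by (simp add: scalar_prod_def lessThan_atLeast0 sum_abs)
  with sum_abs_mult_le_l2_norm[OF assms] show ?thesis by linarith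
qed

lemma l2_norm_le_frobenius:
  assumes A: "A \<in> carrier_mat m n" and v: "v \<in> carrier_vec m" and c: "0 \<le> c"
    and le: "\<And>i. i < m \<Longrightarrow> \<bar>v $ i\<bar> \<le> c * l2_norm (row A i)"
  shows "l2_norm v \<le> c * frobenius_norm A"
proof -
  have "(l2_norm v)\<^sup>2 = (\<Sum>i<m. \<bar>v $ i\<bar>\<^sup>2)"
    using v by (simp add: l2_norm_eq L2_set_def sum_nonneg)
  also have "\<dots> \<le> (\<Sum>i<m. (c * l2_norm (row A i))\<^sup>2)"
    using le by (intro sum_mono power_mono) auto
  also have "\<dots> = (c * frobenius_norm A)\<^sup>2"
    using A by (simp add: power_mult_distrib frobenius_norm_eq_sum_rows sum_distrib_left)
  finally show ?thesis
    using c by (simp add: power2_le_iff_abs_le)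
qed

lemma l2_norm_mult_mat_vec_le_frobenius:
  assumes "A \<in> carrier_mat m n" "v \<in> carrier_vec n"
  shows "l2_norm (A *\<^sub>v v) \<le> l2_norm v * frobenius_norm A"
  using assms abs_scalar_prod_le[of "row A _" n v]
  by (intro l2_norm_le_frobenius) (auto simp: mult.commute)

lemma l2_norm_mult_mat_vec_le_op_norm:
  assumes A: "A \<in> carrier_mat m n" and v: "v \<in> carrier_vec n"
  shows "l2_norm (A *\<^sub>v v) \<le> op_norm A * l2_norm v"
proof (cases "l2_norm v = 0")
  case True
  then show ?thesis
    using l2_norm_mult_mat_vec_le_frobenius[OF assms] by simp
next
  case False
  then have pos: "l2_norm v > 0" by (simp add: less_le)
  have "l2_norm (A *\<^sub>v w) / l2_norm w \<le> frobenius_norm A" if "w \<in> carrier_vec n" for w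
    using l2_norm_mult_mat_vec_le_frobenius[OF A that]
    by (cases "l2_norm w = 0") (auto simp: divide_le_eq mult.commute less_le)
  then have "bdd_above ((\<lambda>w. l2_norm (A *\<^sub>v w) / l2_norm w) ` carrier_vec (dim_col A))"
    using A by (auto intro!: bdd_aboveI2)
  then have "l2_norm (A *\<^sub>v v) / l2_norm v \<le> op_norm A"
    unfolding op_norm_def using A v by (intro cSUP_upper) auto
  with pos show ?thesis by (simp add: divide_le_eq)
qed

lemma inverse_mat_cancel:
  assumes A: "A \<in> carrier_mat n n" "invertible_mat A" and v: "v \<in> carrier_vec n"
  shows "inverse_mat A *\<^sub>v (A *\<^sub>v v) = v" "A *\<^sub>v (inverse_mat A *\<^sub>v v) = v"
  using assoc_mult_mat_vec[of "inverse_mat A" n n A n v]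
    assoc_mult_mat_vec[of A n n "inverse_mat A" n v] inverse_mat[OF A] assms by auto

text \<open>
  The vector \<open>v = A A\<^sup>-\<^sup>1 v\<close> has norm at most \<open>\<parallel>A\<parallel>\<^sub>F \<parallel>A\<^sup>-\<^sup>1\<parallel> \<parallel>v\<parallel>\<close>; a nonzero \<open>v\<close> exists because the
  dimension is positive.
\<close>

lemma op_norm_inverse_bounds:
  assumes A: "A \<in> carrier_mat n n" "invertible_mat A" "n \<ge> 1"
  shows "0 < op_norm (inverse_mat A)" "1 \<le> demmel_cond A"
proof -
  let ?B = "inverse_mat A"
  note B = inverse_mat(1)[OF A(1,2)]
  let ?v = "unit_vec n 0 :: real vec"
  have v: "?v \<in> carrier_vec n" by simp
  have nv: "l2_norm ?v = 1"
    using l2_norm_sq[of ?v] A(3) by (simp add: power2_eq_1_iff) (use l2_norm_nonneg[of ?v] in linarith)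
  have Bv: "?B *\<^sub>v ?v \<in> carrier_vec n" using B by auto
  have 1: "l2_norm (?B *\<^sub>v ?v) \<le> op_norm ?B"
    using l2_norm_mult_mat_vec_le_op_norm[OF B v] nv by simp
  have "1 \<le> l2_norm (?B *\<^sub>v ?v) * frobenius_norm A"
    using l2_norm_mult_mat_vec_le_frobenius[OF A(1) Bv] inverse_mat_cancel(2)[OF A(1,2) v] nv by simp
  also have "\<dots> \<le> op_norm ?B * frobenius_norm A"
    using 1 by (intro mult_right_mono) auto
  finally have *: "1 \<le> op_norm ?B * frobenius_norm A" .
  then show "1 \<le> demmel_cond A" by (simp add: demmel_cond_def mult.commute)
  have "0 \<le> op_norm ?B" using 1 l2_norm_nonneg order_trans by blast
  with * show "0 < op_norm ?B" by (auto simp: less_le)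
qed

section \<open>Rounding errors of the vector operations\<close>

definition rep_vec :: "fp_arith \<Rightarrow> nat \<Rightarrow> real vec \<Rightarrow> bool" where
  "rep_vec F n v \<longleftrightarrow> v \<in> carrier_vec n \<and> (\<forall>i<n. exactly_rep F (v $ i))"

lemma standard_modelD:
  assumes "standard_model u F" "exactly_rep F a" "exactly_rep F b"
  shows "exactly_rep F (fp_add F a b)" "\<bar>fp_add F a b - (a + b)\<bar> \<le> u * \<bar>a + b\<bar>"
    and "exactly_rep F (fp_sub F a b)" "\<bar>fp_sub F a b - (a - b)\<bar> \<le> u * \<bar>a - b\<bar>"
    and "exactly_rep F (fp_mul F a b)" "\<bar>fp_mul F a b - a * b\<bar> \<le> u * \<bar>a * b\<bar>"
    and "b \<noteq> 0 \<Longrightarrow> exactly_rep F (fp_div F a b)"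
    and "b \<noteq> 0 \<Longrightarrow> \<bar>fp_div F a b - a / b\<bar> \<le> u * \<bar>a / b\<bar>"
  using assms by (auto simp: standard_model_def fp_op_accurate_def)

lemma exactly_rep_0:
  assumes "standard_model u F"
  shows "exactly_rep F 0"
proof -
  have "\<bar>fp_round F 0 - 0\<bar> \<le> u * \<bar>0\<bar>"
    using assms unfolding standard_model_def by blast
  then show ?thesis by (simp add: exactly_rep_def)
qed

text \<open>
  Each addition inflates the sum of the absolute values by a factor of at most \<open>1 + u\<close> and adds an
  error of at most \<open>u\<close> times that sum; both effects together give \<open>(1 + u)\<^sup>k - 1\<close> after \<open>k\<close>
  additions.
\<close>

lemma foldl_fp_add:
  assumes "standard_model u F" "u \<ge> 0" "exactly_rep F a" "\<forall>y\<in>set ys. exactly_rep F y"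
  shows "exactly_rep F (foldl (fp_add F) a ys) \<and>
    \<bar>foldl (fp_add F) a ys - (a + sum_list ys)\<bar>
      \<le> ((1 + u) ^ length ys - 1) * (\<bar>a\<bar> + (\<Sum>y\<leftarrow>ys. \<bar>y\<bar>))"
  using assms(3,4)
proof (induction ys arbitrary: a)
  case Nil
  then show ?case by simp
next
  case (Cons y ys)
  let ?s = "fp_add F a y" and ?G = "(1 + u) ^ length ys" and ?Y = "\<Sum>y\<leftarrow>ys. \<bar>y\<bar>"
  have s: "exactly_rep F ?s" and err: "\<bar>?s - (a + y)\<bar> \<le> u * \<bar>a + y\<bar>"
    using standard_modelD[OF assms(1), of a y] Cons.prems by auto
  have IH: "exactly_rep F (foldl (fp_add F) ?s ys)"
    "\<bar>foldl (fp_add F) ?s ys - (?s + sum_list ys)\<bar> \<le> (?G - 1) * (\<bar>?s\<bar> + ?Y)"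
    using Cons.IH[OF s] Cons.prems by auto
  have G: "?G \<ge> 1" using assms(2) by simp
  have Y: "0 \<le> ?Y" by (rule sum_list_nonneg) auto
  have ay: "u * \<bar>a + y\<bar> \<le> u * (\<bar>a\<bar> + \<bar>y\<bar>)"
    using assms(2) by (intro mult_left_mono) auto
  have "\<bar>?s\<bar> \<le> (1 + u) * (\<bar>a\<bar> + \<bar>y\<bar>)"
  proof -
    have "\<bar>?s\<bar> \<le> \<bar>a + y\<bar> + \<bar>?s - (a + y)\<bar>" by linarith
    then have "\<bar>?s\<bar> \<le> (\<bar>a\<bar> + \<bar>y\<bar>) + u * (\<bar>a\<bar> + \<bar>y\<bar>)"
      using err ay abs_triangle_ineq[of a y] by linarith
    then show ?thesis by (simp add: distrib_right)
  qed
  moreover have "?Y \<le> (1 + u) * ?Y"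
    using Y assms(2) by (simp add: algebra_simps)
  ultimately have "(?G - 1) * (\<bar>?s\<bar> + ?Y) \<le> (?G - 1) * ((1 + u) * (\<bar>a\<bar> + \<bar>y\<bar> + ?Y))"
    using G by (intro mult_left_mono) (auto simp: algebra_simps)
  moreover have "u * (\<bar>a\<bar> + \<bar>y\<bar>) \<le> u * (\<bar>a\<bar> + \<bar>y\<bar> + ?Y)"
    using Y assms(2) by (intro mult_left_mono) auto
  ultimately have "\<bar>foldl (fp_add F) ?s ys - (a + y + sum_list ys)\<bar>
      \<le> (?G - 1) * ((1 + u) * (\<bar>a\<bar> + \<bar>y\<bar> + ?Y)) + u * (\<bar>a\<bar> + \<bar>y\<bar> + ?Y)"
    using IH(2) err ay by linarith
  also have "\<dots> = ((1 + u) ^ length (y # ys) - 1) * (\<bar>a\<bar> + \<bar>y\<bar> + ?Y)"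
    by (simp add: algebra_simps)
  finally show ?case using IH(1) by (simp add: algebra_simps)
qed

lemma one_plus_power_le:
  fixes u :: real
  assumes "0 \<le> u" "real n * u \<le> 1"
  shows "(1 + u) ^ n - 1 \<le> 2 * real n * u"
proof -
  have "(1 + u) ^ n \<le> exp u ^ n"
    using assms(1) by (intro power_mono) auto
  also have "\<dots> = exp (real n * u)" by (simp add: exp_of_nat_mult)
  also have "\<dots> \<le> 1 + real n * u + (real n * u)\<^sup>2"
    using assms by (intro exp_bound) auto
  also have "\<dots> \<le> 1 + 2 * real n * u"
    using mult_left_le[of "real n * u" "real n * u"] assms by (simp add: power2_eq_square mult.commute)
  finally show ?thesis by simp
qed

lemma fp_inner_error:
  assumes M: "standard_model u F" and u: "0 \<le> u" "real n * u \<le> 1"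
    and v: "rep_vec F n v" and w: "rep_vec F n w"
  shows "exactly_rep F (fp_inner F v w)"
    and "\<bar>fp_inner F v w - v \<bullet> w\<bar> \<le> 2 * real n * u * (l2_norm v * l2_norm w)"
proof -
  have c: "v \<in> carrier_vec n" "w \<in> carrier_vec n" using v w by (auto simp: rep_vec_def)
  let ?p = "\<lambda>i. fp_mul F (v $ i) (w $ i)"
  have p: "exactly_rep F (?p i)" "\<bar>?p i - v $ i * w $ i\<bar> \<le> u * \<bar>v $ i * w $ i\<bar>" if "i < n" for i
    using standard_modelD(5,6)[OF M, of "v $ i" "w $ i"] v w that by (auto simp: rep_vec_def)
  have "exactly_rep F (fp_inner F v w) \<and>
    \<bar>fp_inner F v w - v \<bullet> w\<bar> \<le> 2 * real n * u * (l2_norm v * l2_norm w)"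
  proof (cases n)
    case 0
    then show ?thesis using c exactly_rep_0[OF M] by (simp add: fp_inner_def scalar_prod_def)
  next
    case (Suc m)
    let ?ys = "map ?p [1..<n]" and ?S = "\<Sum>i<n. \<bar>v $ i * w $ i\<bar>"
    have eq: "[0..<n] = 0 # [1..<n]" using Suc by (simp add: upt_conv_Cons)
    have fi: "fp_inner F v w = foldl (fp_add F) (?p 0) ?ys"
      using c by (simp add: fp_inner_def eq)
    have len: "length ?ys = m" using Suc by simp
    have sums: "?p 0 + sum_list ?ys = (\<Sum>i<n. ?p i)"
      using eq by (metis interv_sum_list_conv_sum_set_nat list.simps(9) sum_list.Cons atLeast_upt set_upt
        lessThan_atLeast0)
    have sumsa: "\<bar>?p 0\<bar> + (\<Sum>y\<leftarrow>?ys. \<bar>y\<bar>) = (\<Sum>i<n. \<bar>?p i\<bar>)"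
    proof -
      have "(\<Sum>i<n. \<bar>?p i\<bar>) = sum_list (map (\<lambda>i. \<bar>?p i\<bar>) [0..<n])"
        by (simp add: interv_sum_list_conv_sum_set_nat lessThan_atLeast0)
      also have "\<dots> = \<bar>?p 0\<bar> + (\<Sum>y\<leftarrow>?ys. \<bar>y\<bar>)"
        unfolding eq by (simp add: o_def)
      finally show ?thesis by simp
    qed
    have fold: "exactly_rep F (fp_inner F v w)"
      "\<bar>fp_inner F v w - (\<Sum>i<n. ?p i)\<bar> \<le> ((1 + u) ^ m - 1) * (\<Sum>i<n. \<bar>?p i\<bar>)"
    proof -
      have "\<forall>y\<in>set ?ys. exactly_rep F y" "exactly_rep F (?p 0)" using p(1) Suc by auto
      from foldl_fp_add[OF M u(1) this(2,1)]
      show "exactly_rep F (fp_inner F v w)"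
        "\<bar>fp_inner F v w - (\<Sum>i<n. ?p i)\<bar> \<le> ((1 + u) ^ m - 1) * (\<Sum>i<n. \<bar>?p i\<bar>)"
        unfolding fi[symmetric] sums sumsa len by blast+
    qed
    have err: "\<bar>(\<Sum>i<n. ?p i) - v \<bullet> w\<bar> \<le> u * ?S"
    proof -
      have "\<bar>(\<Sum>i<n. ?p i) - v \<bullet> w\<bar> = \<bar>\<Sum>i<n. ?p i - v $ i * w $ i\<bar>"
        using c by (simp add: scalar_prod_def lessThan_atLeast0 sum_subtractf)
      also have "\<dots> \<le> (\<Sum>i<n. \<bar>?p i - v $ i * w $ i\<bar>)" by (rule sum_abs)
      also have "\<dots> \<le> (\<Sum>i<n. u * \<bar>v $ i * w $ i\<bar>)" using p by (intro sum_mono) auto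
      finally show ?thesis by (simp add: sum_distrib_left)
    qed
    have "(\<Sum>i<n. \<bar>?p i\<bar>) \<le> (\<Sum>i<n. (1 + u) * \<bar>v $ i * w $ i\<bar>)"
    proof (rule sum_mono)
      fix i assume "i \<in> {..<n}"
      then show "\<bar>?p i\<bar> \<le> (1 + u) * \<bar>v $ i * w $ i\<bar>"
        using p(2)[of i] by (simp add: distrib_right)
    qed
    then have "((1 + u) ^ m - 1) * (\<Sum>i<n. \<bar>?p i\<bar>) \<le> ((1 + u) ^ m - 1) * ((1 + u) * ?S)"
      using u(1) by (intro mult_left_mono) (auto simp: sum_distrib_left)
    with fold(2) err have "\<bar>fp_inner F v w - v \<bullet> w\<bar> \<le> ((1 + u) ^ m - 1) * ((1 + u) * ?S) + u * ?S"
      by linarith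
    also have "\<dots> = ((1 + u) ^ n - 1) * ?S" using Suc by (simp add: algebra_simps)
    also have "\<dots> \<le> 2 * real n * u * (l2_norm v * l2_norm w)"
      using one_plus_power_le[OF u] sum_abs_mult_le_l2_norm[OF c] u(1)
      by (intro mult_mono) (auto intro: sum_nonneg)
    finally show ?thesis using fold(1) by blast
  qed
  then show "exactly_rep F (fp_inner F v w)"
    and "\<bar>fp_inner F v w - v \<bullet> w\<bar> \<le> 2 * real n * u * (l2_norm v * l2_norm w)" by auto
qed

lemma fp_vec_add_error:
  assumes M: "standard_model u F" and u: "0 \<le> u" and v: "rep_vec F n v" and w: "rep_vec F n w"
  shows "rep_vec F n (fp_vec_add F v w)"
    and "l2_norm (fp_vec_add F v w - (v + w)) \<le> u * l2_norm (v + w)"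
  using assms by (auto simp: rep_vec_def fp_vec_add_def intro!: standard_modelD[OF M] l2_norm_le_scaled[of _ n])

lemma fp_smult_vec_error:
  assumes M: "standard_model u F" and u: "0 \<le> u" and c: "exactly_rep F c" and v: "rep_vec F n v"
  shows "rep_vec F n (fp_smult_vec F c v)"
    and "l2_norm (fp_smult_vec F c v - c \<cdot>\<^sub>v v) \<le> u * (\<bar>c\<bar> * l2_norm v)"
proof -
  show "rep_vec F n (fp_smult_vec F c v)"
    using assms by (auto simp: rep_vec_def fp_smult_vec_def intro!: standard_modelD[OF M])
  have "l2_norm (fp_smult_vec F c v - c \<cdot>\<^sub>v v) \<le> u * l2_norm (c \<cdot>\<^sub>v v)"
    using assms by (auto simp: rep_vec_def fp_smult_vec_def intro!: standard_modelD[OF M] l2_norm_le_scaled[of _ n])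
  then show "l2_norm (fp_smult_vec F c v - c \<cdot>\<^sub>v v) \<le> u * (\<bar>c\<bar> * l2_norm v)"
    by (simp add: l2_norm_smult)
qed

lemma l2_norm_le_diff:
  assumes "z \<in> carrier_vec n" "x \<in> carrier_vec n"
  shows "l2_norm z \<le> l2_norm (z - x) + l2_norm x"
proof -
  have "z = (z - x) + x" using assms by auto
  then show ?thesis using l2_norm_triangle[of "z - x" n x] assms by auto
qed

text \<open>
  One entry of a residual, for a system whose exact solution is \<open>x\<close>. Expressing the data entry as
  \<open>a \<bullet> x\<close> makes all errors proportional to \<open>\<parallel>a\<parallel>\<close>. The bound serves twice: for the
  numerator of a Kaczmarz step and for the residuals of iterative refinement.
\<close>

lemma fp_residual_entry_error:
  assumes M: "standard_model u F" and u: "0 \<le> u" "8 * real n * u \<le> 1" and n: "n \<ge> 1"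
    and a: "rep_vec F n a" and z: "rep_vec F n z" and x: "x \<in> carrier_vec n"
    and c: "exactly_rep F (a \<bullet> x)"
  shows "exactly_rep F (fp_sub F (a \<bullet> x) (fp_inner F a z))"
    and "\<bar>fp_sub F (a \<bullet> x) (fp_inner F a z) - a \<bullet> (x - z)\<bar>
      \<le> 4 * real n * u * (l2_norm a * (l2_norm (z - x) + l2_norm x))"
proof -
  define g where "g = 2 * real n * u"
  define L where "L = l2_norm a * (l2_norm (z - x) + l2_norm x)"
  have ac: "a \<in> carrier_vec n" "z \<in> carrier_vec n" using a z by (auto simp: rep_vec_def)
  have g: "0 \<le> g" "u \<le> g / 2" "g \<le> 1 / 4"
    using u n mult_right_mono[of 1 "real n" u] by (auto simp: g_def)
  have L: "0 \<le> L" by (simp add: L_def)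
  note S = fp_inner_error[OF M u(1) _ a z]
  have S1: "exactly_rep F (fp_inner F a z)" using S(1) u g by (simp add: g_def)
  have "\<bar>fp_inner F a z - a \<bullet> z\<bar> \<le> g * (l2_norm a * l2_norm z)" using S(2) g by (simp add: g_def)
  also have "\<dots> \<le> g * L"
    unfolding L_def using l2_norm_le_diff[OF ac(2) x] g by (intro mult_left_mono) auto
  finally have S2: "\<bar>fp_inner F a z - a \<bullet> z\<bar> \<le> g * L" .
  have d: "a \<bullet> (x - z) = a \<bullet> x - a \<bullet> z"
    using ac x by (simp add: scalar_prod_minus_distrib)
  have "\<bar>a \<bullet> (x - z)\<bar> \<le> l2_norm a * l2_norm (- (z - x))"
  proof -
    have "x - z = - (z - x)" using ac x by auto
    then show ?thesis using abs_scalar_prod_le[of a n "x - z"] ac x by auto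
  qed
  also have "\<dots> \<le> L" by (simp add: L_def l2_norm_uminus distrib_left)
  finally have dL: "\<bar>a \<bullet> (x - z)\<bar> \<le> L" .
  show "exactly_rep F (fp_sub F (a \<bullet> x) (fp_inner F a z))"
    using standard_modelD(3)[OF M c S1] .
  have "\<bar>fp_sub F (a \<bullet> x) (fp_inner F a z) - (a \<bullet> x - fp_inner F a z)\<bar>
      \<le> u * \<bar>a \<bullet> x - fp_inner F a z\<bar>"
    using standard_modelD(4)[OF M c S1] .
  also have "\<dots> \<le> (g / 2) * (2 * L)"
  proof (intro mult_mono)
    have "g * L \<le> 1 * L" using g L by (intro mult_right_mono) auto
    then show "\<bar>a \<bullet> x - fp_inner F a z\<bar> \<le> 2 * L" using S2 dL d by linarith
  qed (use g in auto)
  finally have "\<bar>fp_sub F (a \<bullet> x) (fp_inner F a z) - a \<bullet> (x - z)\<bar> \<le> 2 * (g * L)"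
    using S2 d by linarith
  then show "\<bar>fp_sub F (a \<bullet> x) (fp_inner F a z) - a \<bullet> (x - z)\<bar>
      \<le> 4 * real n * u * (l2_norm a * (l2_norm (z - x) + l2_norm x))"
    by (simp add: g_def L_def)
qed

section \<open>One step of randomized Kaczmarz\<close>

text \<open>
  The computed update is \<open>q a\<close> with a computed coefficient \<open>q\<close> in place of the exact \<open>q\<^sub>0\<close>. With
  \<open>E = \<parallel>z - x\<parallel> + \<parallel>x\<parallel>\<close> and \<open>g = 2 n u\<close>, the relative error bound of an inner product, the coefficient
  contributes \<open>5 g E\<close>, the scaling of the row \<open>2 g E\<close> and the final addition \<open>2 g E\<close>.
  The assumption on \<open>n u\<close> keeps the computed \<open>\<parallel>a\<parallel>\<^sup>2\<close> above \<open>3 / 4\<close> of its true value, so that the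
  division is harmless.
\<close>

lemma fp_kaczmarz_step_error:
  assumes M: "standard_model u F" and u: "0 \<le> u" "8 * real n * u \<le> 1" and n: "n \<ge> 1"
    and a: "rep_vec F n (row A r)" "l2_norm (row A r) \<noteq> 0"
    and z: "rep_vec F n z" and x: "x \<in> carrier_vec n"
    and c: "exactly_rep F (c $ r)" "c $ r = row A r \<bullet> x"
  defines "proj \<equiv> (z - x) - ((row A r \<bullet> (z - x)) / (l2_norm (row A r))\<^sup>2) \<cdot>\<^sub>v row A r"
  shows "rep_vec F n (fp_kaczmarz_step F A c r z)"
    and "l2_norm (fp_kaczmarz_step F A c r z - x)
      \<le> l2_norm proj + 18 * real n * u * (l2_norm (z - x) + l2_norm x)"
proof -
  define g where "g = 2 * real n * u"
  define E where "E = l2_norm (z - x) + l2_norm x"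
  let ?a = "row A r"
  define m where "m = l2_norm ?a"
  define D where "D = fp_sub F (c $ r) (fp_inner F ?a z)"
  define W where "W = fp_inner F ?a ?a"
  define q where "q = fp_div F D W"
  define p where "p = fp_smult_vec F q ?a"
  define d where "d = ?a \<bullet> (x - z)"
  define q0 where "q0 = d / m\<^sup>2"
  have ac: "?a \<in> carrier_vec n" "z \<in> carrier_vec n" using a z by (auto simp: rep_vec_def)
  have g: "0 \<le> g" "u \<le> g / 2" "g \<le> 1 / 4"
    using u n mult_right_mono[of 1 "real n" u] by (auto simp: g_def)
  have m: "m > 0" using a(2) by (simp add: m_def less_le)
  have E: "0 \<le> E" by (simp add: E_def)
  have gE: "0 \<le> g * E" "g * E \<le> E / 4" using g E mult_right_mono[of g "1/4" E] by auto
  have D: "exactly_rep F D" "\<bar>D - d\<bar> \<le> 2 * g * (m * E)"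
    using fp_residual_entry_error[OF M u n a(1) z x] c
    by (auto simp: D_def d_def g_def m_def E_def)
  have W: "exactly_rep F W" "\<bar>W - m\<^sup>2\<bar> \<le> g * m\<^sup>2"
    using fp_inner_error[OF M u(1) _ a(1) a(1)] g u
    by (auto simp: W_def g_def m_def l2_norm_sq[symmetric] power2_eq_square)
  have "g * m\<^sup>2 \<le> m\<^sup>2 / 4" using g mult_right_mono[of g "1/4" "m\<^sup>2"] by auto
  then have Wge: "W \<ge> 3 / 4 * m\<^sup>2" using W(2) by linarith
  have Wpos: "W > 0" using Wge m by (smt (verit) zero_less_power mult_pos_pos divide_pos_pos)
  have dle: "\<bar>d\<bar> \<le> m * E"
  proof -
    have "x - z = - (z - x)" using ac x by auto
    then have "\<bar>d\<bar> \<le> m * l2_norm (z - x)"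
      using abs_scalar_prod_le[of ?a n "x - z"] ac x unfolding d_def m_def by (simp add: l2_norm_uminus)
    also have "\<dots> \<le> m * E" using m by (intro mult_left_mono) (auto simp: E_def)
    finally show ?thesis .
  qed
  have q0: "\<bar>q0\<bar> * m \<le> E"
    using dle m by (simp add: q0_def abs_mult power2_eq_square field_simps)
  \<comment> \<open>Of the factor 3 over the common denominator, 2 comes from \<open>D\<close> and 1 from \<open>W\<close>; the lower bound
    \<open>3 / 4 m\<^sup>2\<close> for \<open>W\<close> raises it to 4.\<close>
  have num: "\<bar>D / W - q0\<bar> * m \<le> 4 * (g * E)"
  proof -
    have "D / W - q0 = ((D - d) * m\<^sup>2 - d * (W - m\<^sup>2)) / (W * m\<^sup>2)"
      using Wpos m by (simp add: q0_def field_simps)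
    moreover have "\<bar>(D - d) * m\<^sup>2 - d * (W - m\<^sup>2)\<bar> \<le> 3 * (g * E) * (m * m\<^sup>2)"
    proof -
      have "\<bar>(D - d) * m\<^sup>2\<bar> \<le> 2 * g * (m * E) * m\<^sup>2"
        using D(2) by (simp add: abs_mult mult_right_mono)
      moreover have "\<bar>d * (W - m\<^sup>2)\<bar> \<le> (m * E) * (g * m\<^sup>2)"
        unfolding abs_mult using dle W(2) m E by (intro mult_mono) auto
      ultimately show ?thesis by (simp add: algebra_simps)
    qed
    ultimately have "\<bar>D / W - q0\<bar> \<le> 3 * (g * E) * (m * m\<^sup>2) / (W * m\<^sup>2)"
      using m Wpos by (simp only: abs_divide abs_mult[of W] abs_of_pos zero_less_power divide_right_mono
          mult_nonneg_nonneg less_imp_le)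
    then have "\<bar>D / W - q0\<bar> * m \<le> 3 * (g * E) * (m * m\<^sup>2) / (W * m\<^sup>2) * m"
      using m by (intro mult_right_mono) auto
    also have "\<dots> = 3 * (g * E) * (m\<^sup>2 / W)"
      using m Wpos by (simp add: field_simps power2_eq_square)
    also have "\<dots> \<le> 3 * (g * E) * (4 / 3)"
      using Wge Wpos gE by (intro mult_left_mono) (auto simp: divide_le_eq)
    finally show ?thesis by (simp add: mult_ac)
  qed
  have q: "exactly_rep F q" "\<bar>q - D / W\<bar> \<le> u * \<bar>D / W\<bar>"
    using standard_modelD(7,8)[OF M D(1) W(1)] Wpos by (auto simp: q_def)
  have DW: "\<bar>D / W\<bar> * m \<le> 2 * E"
  proof -
    have "\<bar>D / W\<bar> * m \<le> (\<bar>D / W - q0\<bar> + \<bar>q0\<bar>) * m" using m by (intro mult_right_mono) auto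
    then show ?thesis using num q0 gE by (simp add: distrib_right)
  qed
  have qerr: "\<bar>q - q0\<bar> * m \<le> 5 * (g * E)"
  proof -
    have "\<bar>q - q0\<bar> * m \<le> (u * \<bar>D / W\<bar> + \<bar>D / W - q0\<bar>) * m" using m q(2) by (intro mult_right_mono) auto
    moreover have "u * (\<bar>D / W\<bar> * m) \<le> (g / 2) * (2 * E)"
      by (rule mult_mono) (use g DW m in auto)
    ultimately show ?thesis using num by (simp add: algebra_simps)
  qed
  have qm: "\<bar>q\<bar> * m \<le> 9 / 4 * E"
  proof -
    have "\<bar>q\<bar> * m \<le> (\<bar>q - q0\<bar> + \<bar>q0\<bar>) * m" using m by (intro mult_right_mono) auto
    then show ?thesis using qerr q0 gE by (simp add: distrib_right)
  qed
  note p = fp_smult_vec_error[OF M u(1) q(1) a(1), folded p_def]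
  have pc: "p \<in> carrier_vec n" using p(1) by (simp add: rep_vec_def)
  have "u * (\<bar>q\<bar> * m) \<le> (g / 2) * (9 / 4 * E)" by (rule mult_mono) (use g qm m in auto)
  with p(2) have perr1: "l2_norm (p - q \<cdot>\<^sub>v ?a) \<le> 2 * (g * E)" using gE by (simp add: m_def)
  have perr: "l2_norm (p - q0 \<cdot>\<^sub>v ?a) \<le> 7 * (g * E)"
  proof -
    have "p - q0 \<cdot>\<^sub>v ?a = (p - q \<cdot>\<^sub>v ?a) + (q - q0) \<cdot>\<^sub>v ?a"
      using ac pc by (auto simp: algebra_simps)
    then have "l2_norm (p - q0 \<cdot>\<^sub>v ?a) \<le> l2_norm (p - q \<cdot>\<^sub>v ?a) + \<bar>q - q0\<bar> * m"
      using l2_norm_triangle[of "p - q \<cdot>\<^sub>v ?a" n "(q - q0) \<cdot>\<^sub>v ?a"] ac pc by (auto simp: m_def l2_norm_smult)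
    then show ?thesis using perr1 qerr by linarith
  qed
  have pn: "l2_norm p \<le> 3 * E"
  proof -
    have "l2_norm p \<le> l2_norm (p - q0 \<cdot>\<^sub>v ?a) + \<bar>q0\<bar> * m"
      using l2_norm_le_diff[of p n "q0 \<cdot>\<^sub>v ?a"] ac pc by (auto simp: m_def l2_norm_smult)
    then show ?thesis using perr q0 gE by linarith
  qed
  have step: "fp_kaczmarz_step F A c r z = fp_vec_add F z p"
    by (simp add: fp_kaczmarz_step_def p_def q_def D_def W_def)
  note s = fp_vec_add_error[OF M u(1) z p(1), folded step]
  show "rep_vec F n (fp_kaczmarz_step F A c r z)" by (rule s(1))
  let ?s = "fp_kaczmarz_step F A c r z"
  have sc: "?s \<in> carrier_vec n" using s(1) by (simp add: rep_vec_def)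
  have "l2_norm (z + p) \<le> 4 * E"
    using l2_norm_triangle[OF ac(2) pc] l2_norm_le_diff[OF ac(2) x] pn by (simp add: E_def)
  then have "u * l2_norm (z + p) \<le> (g / 2) * (4 * E)" using g by (intro mult_mono) auto
  with s(2) have serr: "l2_norm (?s - (z + p)) \<le> 2 * (g * E)" by (simp add: mult_ac)
  have q0': "(?a \<bullet> (z - x)) / m\<^sup>2 = - q0"
    using ac x by (simp add: q0_def d_def scalar_prod_minus_distrib diff_divide_distrib)
  have projc: "proj \<in> carrier_vec n" using ac x by (auto simp: proj_def)
  have "?s - x = (?s - (z + p)) + ((p - q0 \<cdot>\<^sub>v ?a) + proj)"
    unfolding proj_def m_def[symmetric] q0'
    using ac pc x sc carrier_vecD[OF ac(1), unfolded index_row] by (intro eq_vecI) auto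
  then have "l2_norm (?s - x) \<le> l2_norm (?s - (z + p)) + (l2_norm (p - q0 \<cdot>\<^sub>v ?a) + l2_norm proj)"
    using l2_norm_triangle[of "?s - (z + p)" n "(p - q0 \<cdot>\<^sub>v ?a) + proj"]
      l2_norm_triangle[of "p - q0 \<cdot>\<^sub>v ?a" n proj] sc ac pc projc by fastforce
  also have "\<dots> \<le> l2_norm proj + 9 * (g * E)" using serr perr by linarith
  finally show "l2_norm (?s - x) \<le> l2_norm proj + 18 * real n * u * (l2_norm (z - x) + l2_norm x)"
    by (simp add: g_def E_def)
qed

text \<open>
  By Pythagoras the projection has squared norm \<open>\<parallel>e\<parallel>\<^sup>2 - (a \<bullet> e)\<^sup>2 / \<parallel>a\<parallel>\<^sup>2\<close>, and the inequality of
  arithmetic and geometric means, \<open>2 \<parallel>p\<parallel> \<parallel>e\<parallel> \<le> \<parallel>p\<parallel>\<^sup>2 + \<parallel>e\<parallel>\<^sup>2\<close>, removes the square root. The resulting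
  bound on the norm itself is quadratic in \<open>a \<bullet> e\<close>, so it can be averaged over the rows
  directly, in place of an appeal to Jensen's inequality. For \<open>e = 0\<close> the quotient is
  \<open>0 / 0 = 0\<close>.
\<close>

lemma projection_l2_norm_le:
  assumes a: "a \<in> carrier_vec n" "l2_norm a \<noteq> 0" and e: "e \<in> carrier_vec n"
  shows "l2_norm (e - ((a \<bullet> e) / (l2_norm a)\<^sup>2) \<cdot>\<^sub>v a)
    \<le> l2_norm e - (a \<bullet> e)\<^sup>2 / (2 * (l2_norm a)\<^sup>2 * l2_norm e)"
proof (cases "l2_norm e = 0")
  case True
  have "\<bar>a \<bullet> e\<bar> \<le> 0" using abs_scalar_prod_le[OF a(1) e] True by simp
  moreover have "e - 0 \<cdot>\<^sub>v a = e" using a e by auto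
  ultimately show ?thesis using True by simp
next
  case False
  let ?m = "l2_norm a" and ?N = "l2_norm e" and ?s = "a \<bullet> e"
  let ?q = "e - (?s / ?m\<^sup>2) \<cdot>\<^sub>v a"
  have pos: "?m > 0" "?N > 0" using a(2) False by (simp_all add: less_le)
  have ea: "e \<bullet> a = ?s" using a e by (simp add: comm_scalar_prod[of e n a])
  have aa: "a \<bullet> a = ?m\<^sup>2" and ee: "e \<bullet> e = ?N\<^sup>2" by (simp_all add: l2_norm_sq)
  have "(l2_norm ?q)\<^sup>2 = ?q \<bullet> ?q" by (rule l2_norm_sq)
  also have "\<dots> = ?N\<^sup>2 - ?s\<^sup>2 / ?m\<^sup>2"
    using a e pos
    by (simp add: minus_scalar_prod_distrib[where n = n] scalar_prod_minus_distrib[where n = n] ea aa ee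
        field_simps power2_eq_square)
  finally have sq: "(l2_norm ?q)\<^sup>2 = ?N\<^sup>2 - ?s\<^sup>2 / ?m\<^sup>2" .
  have "2 * l2_norm ?q * ?N \<le> (l2_norm ?q)\<^sup>2 + ?N\<^sup>2" by (rule sum_squares_bound)
  with sq have "2 * l2_norm ?q * ?N \<le> 2 * ?N\<^sup>2 - ?s\<^sup>2 / ?m\<^sup>2" by simp
  then have "l2_norm ?q \<le> (2 * ?N\<^sup>2 - ?s\<^sup>2 / ?m\<^sup>2) / (2 * ?N)"
    using pos by (simp add: le_divide_eq mult_ac)
  also have "\<dots> = ?N - ?s\<^sup>2 / (2 * ?m\<^sup>2 * ?N)"
    using pos by (simp add: field_simps power2_eq_square)
  finally show ?thesis .
qed

lemma expectation_row_pmf: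
  assumes "frobenius_norm A \<noteq> 0"
  shows "measure_pmf.expectation (row_pmf A) h
    = (\<Sum>r<dim_row A. (l2_norm (row A r))\<^sup>2 / (frobenius_norm A)\<^sup>2 * h r)"
  by (subst integral_measure_pmf[of "{..<dim_row A}"])
    (auto simp: set_pmf_eq pmf_row_pmf[OF assms] split: if_splits)

lemma set_row_pmf:
  assumes "frobenius_norm A \<noteq> 0" "r \<in> set_pmf (row_pmf A)"
  shows "r < dim_row A" "l2_norm (row A r) \<noteq> 0"
  using assms by (auto simp: set_pmf_eq pmf_row_pmf split: if_splits)

text \<open>
  The weights \<open>\<parallel>a\<^sub>r\<parallel>\<^sup>2 / \<parallel>A\<parallel>\<^sub>F\<^sup>2\<close> cancel the normalisation of the rows, so the average decrease is
  \<open>\<parallel>A e\<parallel>\<^sup>2 / (2 \<parallel>A\<parallel>\<^sub>F\<^sup>2 \<parallel>e\<parallel>)\<close>, and \<open>\<parallel>e\<parallel> \<le> \<parallel>A\<^sup>-\<^sup>1\<parallel> \<parallel>A e\<parallel>\<close> turns this into a fraction of \<open>\<parallel>e\<parallel>\<close>.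
\<close>

lemma expected_projection_l2_norm_le:
  assumes A: "A \<in> carrier_mat n n" "invertible_mat A" "n \<ge> 1" and e: "e \<in> carrier_vec n"
  shows "measure_pmf.expectation (row_pmf A)
      (\<lambda>r. l2_norm (e - ((row A r \<bullet> e) / (l2_norm (row A r))\<^sup>2) \<cdot>\<^sub>v row A r))
    \<le> (1 - 1 / (2 * (demmel_cond A)\<^sup>2)) * l2_norm e"
proof -
  let ?f = "frobenius_norm A" and ?b = "op_norm (inverse_mat A)" and ?N = "l2_norm e"
  have F: "?f \<noteq> 0" using op_norm_inverse_bounds[OF A] by (auto simp: demmel_cond_def)
  have b: "?b > 0" using op_norm_inverse_bounds[OF A] by simp
  have Ae: "A *\<^sub>v e \<in> carrier_vec n" using A e by auto
  have "measure_pmf.expectation (row_pmf A)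
      (\<lambda>r. l2_norm (e - ((row A r \<bullet> e) / (l2_norm (row A r))\<^sup>2) \<cdot>\<^sub>v row A r))
    \<le> (\<Sum>r<n. (l2_norm (row A r))\<^sup>2 / ?f\<^sup>2 * ?N - (row A r \<bullet> e)\<^sup>2 / (2 * ?f\<^sup>2 * ?N))"
    unfolding expectation_row_pmf[OF F] using A(1)
  proof (simp, intro sum_mono)
    fix r assume r: "r \<in> {..<n}"
    let ?a = "row A r"
    have a: "?a \<in> carrier_vec n" using A r by auto
    show "(l2_norm ?a)\<^sup>2 * l2_norm (e - (?a \<bullet> e / (l2_norm ?a)\<^sup>2) \<cdot>\<^sub>v ?a) / ?f\<^sup>2
      \<le> (l2_norm ?a)\<^sup>2 * ?N / ?f\<^sup>2 - (?a \<bullet> e)\<^sup>2 / (2 * ?f\<^sup>2 * ?N)"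
    proof (cases "l2_norm ?a = 0")
      case True
      then have "?a \<bullet> e = 0" using abs_scalar_prod_le[OF a e] by simp
      then show ?thesis using True by simp
    next
      case False
      have "(l2_norm ?a)\<^sup>2 * l2_norm (e - (?a \<bullet> e / (l2_norm ?a)\<^sup>2) \<cdot>\<^sub>v ?a) / ?f\<^sup>2
        \<le> (l2_norm ?a)\<^sup>2 * (?N - (?a \<bullet> e)\<^sup>2 / (2 * (l2_norm ?a)\<^sup>2 * ?N)) / ?f\<^sup>2"
        using projection_l2_norm_le[OF a False e] by (intro divide_right_mono mult_left_mono) auto
      also have "\<dots> = (l2_norm ?a)\<^sup>2 * ?N / ?f\<^sup>2 - (?a \<bullet> e)\<^sup>2 / (2 * ?f\<^sup>2 * ?N)"
        using False F by (cases "?N = 0") (auto simp: field_simps)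
      finally show ?thesis .
    qed
  qed
  also have "\<dots> = ?N - (l2_norm (A *\<^sub>v e))\<^sup>2 / (2 * ?f\<^sup>2 * ?N)"
  proof -
    have "(\<Sum>r<n. (l2_norm (row A r))\<^sup>2 / ?f\<^sup>2 * ?N) = ?N"
    proof -
      have "(\<Sum>r<n. (l2_norm (row A r))\<^sup>2 / ?f\<^sup>2 * ?N) = (\<Sum>r<n. (l2_norm (row A r))\<^sup>2) / ?f\<^sup>2 * ?N"
        unfolding sum_distrib_right[symmetric] sum_divide_distrib[symmetric] ..
      also have "(\<Sum>r<n. (l2_norm (row A r))\<^sup>2) = ?f\<^sup>2"
        using A(1) frobenius_norm_eq_sum_rows[of A] by simp
      finally show ?thesis using F by simp
    qed
    moreover have "(\<Sum>r<n. (row A r \<bullet> e)\<^sup>2) = (l2_norm (A *\<^sub>v e))\<^sup>2"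
      using A(1) by (simp add: l2_norm_def L2_set_def sum_nonneg)
    ultimately show ?thesis
      by (simp add: sum_subtractf sum_divide_distrib[symmetric])
  qed
  also have "\<dots> \<le> ?N - 1 / (2 * (demmel_cond A)\<^sup>2) * ?N"
  proof (cases "?N = 0")
    case False
    then have N: "?N > 0" by (simp add: less_le)
    have "?N \<le> ?b * l2_norm (A *\<^sub>v e)"
      using l2_norm_mult_mat_vec_le_op_norm[OF inverse_mat(1)[OF A(1,2)] Ae]
        inverse_mat_cancel(1)[OF A(1,2) e] by simp
    then have "?N\<^sup>2 \<le> (?b * l2_norm (A *\<^sub>v e))\<^sup>2" by (intro power_mono) auto
    then have "?N\<^sup>2 / ?b\<^sup>2 \<le> (l2_norm (A *\<^sub>v e))\<^sup>2"
      using b by (simp add: divide_le_eq power_mult_distrib mult.commute)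
    then have "?N\<^sup>2 / ?b\<^sup>2 / (2 * ?f\<^sup>2 * ?N) \<le> (l2_norm (A *\<^sub>v e))\<^sup>2 / (2 * ?f\<^sup>2 * ?N)"
      using N by (intro divide_right_mono) auto
    moreover have "?N\<^sup>2 / ?b\<^sup>2 / (2 * ?f\<^sup>2 * ?N) = 1 / (2 * (demmel_cond A)\<^sup>2) * ?N"
      using N b F by (simp add: demmel_cond_def field_simps power2_eq_square)
    ultimately show ?thesis by simp
  qed simp
  finally show ?thesis by (simp add: algebra_simps)
qed

section \<open>Expectations along a chain of finitely supported steps\<close>

lemma expectation_mono_finite:
  fixes f g :: "'a \<Rightarrow> real"
  assumes "finite (set_pmf p)" "\<And>x. x \<in> set_pmf p \<Longrightarrow> f x \<le> g x"
  shows "measure_pmf.expectation p f \<le> measure_pmf.expectation p g"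
  using assms by (intro integral_mono_AE integrable_measure_pmf_finite) (auto simp: AE_measure_pmf_iff)

lemma expectation_affine_finite:
  fixes f :: "'a \<Rightarrow> real"
  assumes "finite (set_pmf p)"
  shows "measure_pmf.expectation p (\<lambda>x. \<alpha> * f x + \<beta>) = \<alpha> * measure_pmf.expectation p f + \<beta>"
  using assms by (simp add: integrable_measure_pmf_finite)

text \<open>
  The tower property in the form of a drift inequality: a conditional bound that is affine in a
  quantity \<open>k\<close> of the current state passes to expectations.
\<close>

lemma expectation_bind_affine_le:
  fixes h :: "'b \<Rightarrow> real"
  assumes p: "finite (set_pmf p)" and f: "\<And>x. x \<in> set_pmf p \<Longrightarrow> finite (set_pmf (f x))"
    and le: "\<And>x. x \<in> set_pmf p \<Longrightarrow> measure_pmf.expectation (f x) h \<le> \<alpha> * k x + \<beta>"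
  shows "measure_pmf.expectation (bind_pmf p f) h \<le> \<alpha> * measure_pmf.expectation p k + \<beta>"
proof -
  have "measure_pmf.expectation (bind_pmf p f) h
      = (\<Sum>x\<in>set_pmf p. pmf p x *\<^sub>R measure_pmf.expectation (f x) h)"
    using p f by (intro pmf_expectation_bind) auto
  also have "\<dots> = measure_pmf.expectation p (\<lambda>x. measure_pmf.expectation (f x) h)"
    using p by (subst integral_measure_pmf[of "set_pmf p"]) auto
  also have "\<dots> \<le> measure_pmf.expectation p (\<lambda>x. \<alpha> * k x + \<beta>)"
    by (rule expectation_mono_finite[OF p le])
  also have "\<dots> = \<alpha> * measure_pmf.expectation p k + \<beta>"
    by (rule expectation_affine_finite[OF p])
  finally show ?thesis .
qed

lemma affine_recursion_bound:
  fixes s :: "nat \<Rightarrow> real"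
  assumes "0 \<le> \<alpha>" "\<And>k. s (Suc k) \<le> \<alpha> * s k + (1 - \<alpha>) * L"
  shows "s k \<le> \<alpha> ^ k * (s 0 - L) + L"
proof (induction k)
  case (Suc k)
  have "s (Suc k) \<le> \<alpha> * (\<alpha> ^ k * (s 0 - L) + L) + (1 - \<alpha>) * L"
    using assms(2)[of k] mult_left_mono[OF Suc.IH assms(1)] by linarith
  then show ?case by (simp add: algebra_simps)
qed simp

section \<open>Accuracy of one solve\<close>

context
  fixes n :: nat and A :: "real mat" and u :: real and F :: fp_arith
  assumes n: "n \<ge> 1" and A: "A \<in> carrier_mat n n" "invertible_mat A"
    and u: "u > 0" and M: "standard_model u F"
    and A_rep: "\<And>i. i < n \<Longrightarrow> rep_vec F n (row A i)"
    and small: "1000 * real n * u * (demmel_cond A)\<^sup>2 \<le> 1"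
begin

private lemma cond_ge_1: "1 \<le> demmel_cond A" "1 \<le> (demmel_cond A)\<^sup>2"
  using op_norm_inverse_bounds(2)[OF A n] by auto

private lemma frobenius_nonzero: "frobenius_norm A \<noteq> 0"
  using cond_ge_1 by (auto simp: demmel_cond_def)

private lemma nu_bounds: "1000 * real n * u \<le> 1" "u \<le> real n * u" "0 < real n * u"
proof -
  have "1000 * real n * u * 1 \<le> 1000 * real n * u * (demmel_cond A)\<^sup>2"
    using cond_ge_1(2) u by (intro mult_left_mono) auto
  with small show "1000 * real n * u \<le> 1" by linarith
  show "u \<le> real n * u" "0 < real n * u" using u n by auto
qed

private lemma set_fp_kaczmarz_rep:
  assumes c: "rep_vec F n c" and z: "z \<in> set_pmf (fp_kaczmarz F A c k)"
  shows "rep_vec F n z"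
  using z
proof (induction k arbitrary: z)
  case 0
  then show ?case using A exactly_rep_0[OF M] by (simp add: rep_vec_def)
next
  case (Suc k)
  from Suc.prems obtain y r where y: "y \<in> set_pmf (fp_kaczmarz F A c k)"
    and r: "r \<in> set_pmf (row_pmf A)" and z: "z = fp_kaczmarz_step F A c r y"
    by auto
  have r': "r < n" "l2_norm (row A r) \<noteq> 0" using set_row_pmf[OF frobenius_nonzero r] A by auto
  define x where "x = inverse_mat A *\<^sub>v c"
  have cc: "c \<in> carrier_vec n" using c by (simp add: rep_vec_def)
  have x: "x \<in> carrier_vec n" using inverse_mat(1)[OF A] cc by (auto simp: x_def)
  have "c $ r = row A r \<bullet> x"
    using inverse_mat_cancel(2)[OF A cc] r' A by (metis carrier_matD(1) index_mult_mat_vec x_def)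
  then show ?case
    unfolding z using fp_kaczmarz_step_error(1)[OF M _ _ n A_rep[OF r'(1)] r'(2) Suc.IH[OF y] x]
      c r' u nu_bounds by (auto simp: rep_vec_def)
qed

text \<open>
  The rounding error per step is at most \<open>\<eta> (\<parallel>e\<parallel> + \<parallel>x\<parallel>)\<close> with \<open>\<eta> = 18 n u \<le> 1 / (4 \<kappa>\<^sup>2)\<close>. Its first
  part uses up half of the gain \<open>1 / (2 \<kappa>\<^sup>2)\<close>; its second part shifts the fixed point of the recursion
  to \<open>4 \<kappa>\<^sup>2 \<eta> \<parallel>x\<parallel> \<le> \<parallel>x\<parallel> / 8\<close>. The other eighth is \<open>(1 - 1 / (4 \<kappa>\<^sup>2))\<^sup>k \<le> exp (- 3) \<le> 1 / 8\<close>.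
\<close>

lemma fp_kaczmarz_expected_error:
  assumes c: "rep_vec F n c" and k: "real k \<ge> 12 * (demmel_cond A)\<^sup>2"
  shows "measure_pmf.expectation (fp_kaczmarz F A c k) (\<lambda>z. l2_norm (z - inverse_mat A *\<^sub>v c))
    \<le> l2_norm (inverse_mat A *\<^sub>v c) / 4"
proof -
  define x where "x = inverse_mat A *\<^sub>v c"
  let ?K = "(demmel_cond A)\<^sup>2"
  define X where "X = l2_norm x"
  define \<eta> where "\<eta> = 18 * real n * u"
  define \<alpha> where "\<alpha> = 1 - 1 / (4 * ?K)"
  have X: "0 \<le> X" by (simp add: X_def)
  have cc: "c \<in> carrier_vec n" using c by (simp add: rep_vec_def)
  have x: "x \<in> carrier_vec n" using inverse_mat(1)[OF A] cc by (auto simp: x_def)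
  have cx: "c $ r = row A r \<bullet> x" if "r < n" for r
    using inverse_mat_cancel(2)[OF A cc] that A by (metis carrier_matD(1) index_mult_mat_vec x_def)
  have "1 / (4 * ?K) \<le> 1" using cond_ge_1(2) by (subst divide_le_eq_1_pos) linarith+
  then have \<alpha>: "0 \<le> \<alpha>" by (simp add: \<alpha>_def)
  have \<eta>: "\<eta> \<le> 1 / (4 * ?K)" "4 * ?K * \<eta> \<le> 1 / 8"
    using small cond_ge_1 by (auto simp: \<eta>_def field_simps)
  have fin: "finite (set_pmf (fp_kaczmarz F A c k))" for k
    by (rule finite_set_fp_kaczmarz[OF frobenius_nonzero])
  have fr: "finite (set_pmf (row_pmf A))" by (rule finite_set_row_pmf[OF frobenius_nonzero])
  define s where "s k = measure_pmf.expectation (fp_kaczmarz F A c k) (\<lambda>z. l2_norm (z - x))" for k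
  have rec: "s (Suc k) \<le> \<alpha> * s k + (1 - \<alpha>) * (4 * ?K * \<eta> * X)" for k
  proof -
    have "s (Suc k) \<le> \<alpha> * s k + \<eta> * X"
      unfolding s_def fp_kaczmarz.simps
    proof (rule expectation_bind_affine_le[OF fin])
      fix z assume "z \<in> set_pmf (fp_kaczmarz F A c k)"
      then have z: "rep_vec F n z" by (rule set_fp_kaczmarz_rep[OF c])
      have e: "z - x \<in> carrier_vec n" using x z by (auto simp: rep_vec_def)
      let ?proj = "\<lambda>r. l2_norm ((z - x) - ((row A r \<bullet> (z - x)) / (l2_norm (row A r))\<^sup>2) \<cdot>\<^sub>v row A r)"
      show "finite (set_pmf (row_pmf A \<bind> (\<lambda>r. return_pmf (fp_kaczmarz_step F A c r z))))"
        using fr by simp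
      have "measure_pmf.expectation (row_pmf A \<bind> (\<lambda>r. return_pmf (fp_kaczmarz_step F A c r z)))
          (\<lambda>z. l2_norm (z - x)) \<le> 1 * measure_pmf.expectation (row_pmf A) ?proj
            + \<eta> * (l2_norm (z - x) + X)"
      proof (rule expectation_bind_affine_le[OF fr])
        fix r assume "r \<in> set_pmf (row_pmf A)"
        then have r: "r < n" "l2_norm (row A r) \<noteq> 0" using set_row_pmf[OF frobenius_nonzero] A by auto
        show "measure_pmf.expectation (return_pmf (fp_kaczmarz_step F A c r z)) (\<lambda>z. l2_norm (z - x))
          \<le> 1 * ?proj r + \<eta> * (l2_norm (z - x) + X)"
          using fp_kaczmarz_step_error(2)[OF M _ _ n A_rep[OF r(1)] r(2) z x _ cx[OF r(1)]]
            c r u nu_bounds by (auto simp: rep_vec_def \<eta>_def X_def)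
      qed simp
      also have "\<dots> \<le> (1 - 1 / (2 * ?K)) * l2_norm (z - x) + \<eta> * (l2_norm (z - x) + X)"
        using expected_projection_l2_norm_le[OF A n e] by simp
      also have "\<dots> = (1 - 1 / (2 * ?K) + \<eta>) * l2_norm (z - x) + \<eta> * X"
        by (simp add: algebra_simps)
      also have "\<dots> \<le> \<alpha> * l2_norm (z - x) + \<eta> * X"
        using \<eta>(1) by (intro add_right_mono mult_right_mono) (auto simp: \<alpha>_def field_simps)
      finally show "measure_pmf.expectation
          (row_pmf A \<bind> (\<lambda>r. return_pmf (fp_kaczmarz_step F A c r z))) (\<lambda>z. l2_norm (z - x))
        \<le> \<alpha> * l2_norm (z - x) + \<eta> * X" .
    qed
    also have "\<eta> * X = (1 - \<alpha>) * (4 * ?K * \<eta> * X)"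
      using cond_ge_1 by (simp add: \<alpha>_def field_simps)
    finally show ?thesis .
  qed
  have s0: "s 0 = X"
  proof -
    have "0\<^sub>v n - x = - x" using x by auto
    then show ?thesis using A by (simp add: s_def X_def l2_norm_uminus)
  qed
  have pow: "\<alpha> ^ k \<le> 1 / 8"
  proof -
    have "\<alpha> ^ k \<le> exp (- (1 / (4 * ?K))) ^ k"
      using \<alpha> exp_ge_add_one_self[of "- (1 / (4 * ?K))"] by (intro power_mono) (auto simp: \<alpha>_def)
    also have "\<dots> = exp (real k * (- (1 / (4 * ?K))))" by (rule exp_of_nat_mult[symmetric])
    also have "\<dots> \<le> exp (- 3)"
      using k cond_ge_1 by (simp add: field_simps)
    also have "\<dots> = 1 / exp 1 ^ 3" by (simp add: exp_minus exp_of_nat_mult[symmetric] field_simps)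
    also have "\<dots> \<le> 1 / 2 ^ 3"
      using exp_ge_add_one_self[of 1] by (intro divide_left_mono power_mono) auto
    finally show ?thesis by simp
  qed
  have L: "0 \<le> 4 * ?K * \<eta> * X" "4 * ?K * \<eta> * X \<le> X / 8"
    using mult_right_mono[OF \<eta>(2) X] X nu_bounds by (auto simp: \<eta>_def)
  have "s k \<le> \<alpha> ^ k * (X - 4 * ?K * \<eta> * X) + 4 * ?K * \<eta> * X"
    using affine_recursion_bound[OF \<alpha>, of s, OF rec] s0 by simp
  also have "\<dots> \<le> 1 / 8 * X + X / 8"
    using pow L X \<alpha> by (intro add_mono mult_mono) auto
  finally show ?thesis by (simp add: s_def x_def X_def)
qed

section \<open>Iterative refinement\<close>

text \<open>
  The residual entries have errors proportional to the norms of their rows, which add up to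
  \<open>\<parallel>A\<parallel>\<^sub>F\<close>; solving for the correction then costs \<open>\<parallel>A\<^sup>-\<^sup>1\<parallel>\<close>, so the total amplification is
  exactly one \<open>\<kappa>\<close>. The exact correction would be \<open>x - z\<close>.
\<close>

private lemma fp_residual_error:
  assumes b: "rep_vec F n b" and z: "rep_vec F n z"
  defines "x \<equiv> inverse_mat A *\<^sub>v b" and "r \<equiv> fp_vec_sub F b (fp_mult_mat_vec F A z)"
  shows "rep_vec F n r"
    and "l2_norm (inverse_mat A *\<^sub>v r + (z - x))
      \<le> 4 * real n * u * demmel_cond A * (l2_norm (z - x) + l2_norm x)"
proof -
  let ?B = "inverse_mat A"
  note B = inverse_mat(1)[OF A]
  define E where "E = l2_norm (z - x) + l2_norm x"
  have bz: "b \<in> carrier_vec n" "z \<in> carrier_vec n" using b z by (auto simp: rep_vec_def)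
  have x: "x \<in> carrier_vec n" using B bz by (auto simp: x_def)
  have bx: "b $ i = row A i \<bullet> x" if "i < n" for i
    using inverse_mat_cancel(2)[OF A bz(1)] that A by (metis carrier_matD(1) index_mult_mat_vec x_def)
  have r_i: "r $ i = fp_sub F (row A i \<bullet> x) (fp_inner F (row A i) z)" if "i < n" for i
    using that A by (simp add: r_def fp_vec_sub_def fp_mult_mat_vec_def bx)
  have rc: "r \<in> carrier_vec n" using A by (simp add: r_def fp_vec_sub_def fp_mult_mat_vec_def)
  have entry: "exactly_rep F (r $ i)"
    "\<bar>r $ i - row A i \<bullet> (x - z)\<bar> \<le> 4 * real n * u * (l2_norm (row A i) * E)" if "i < n" for i
    using fp_residual_entry_error[OF M _ _ n A_rep[OF that] z x] bx[OF that] b that u nu_bounds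
    unfolding r_i[OF that] E_def by (auto simp: rep_vec_def)
  show "rep_vec F n r" using rc entry by (simp add: rep_vec_def)
  let ?\<delta> = "r - A *\<^sub>v (x - z)"
  have \<delta>: "?\<delta> \<in> carrier_vec n" using rc A x bz by (intro minus_carrier_vec mult_mat_vec_carrier) auto
  have "l2_norm ?\<delta> \<le> (4 * real n * u * E) * frobenius_norm A"
    using entry(2) u A by (intro l2_norm_le_frobenius[OF A(1) \<delta>]) (auto simp: E_def mult_ac)
  then have "op_norm ?B * l2_norm ?\<delta> \<le> op_norm ?B * ((4 * real n * u * E) * frobenius_norm A)"
    using op_norm_inverse_bounds(1)[OF A n] by (intro mult_left_mono) auto
  moreover have "?B *\<^sub>v r + (z - x) = ?B *\<^sub>v ?\<delta>"
  proof -
    have "?B *\<^sub>v ?\<delta> = ?B *\<^sub>v r - ?B *\<^sub>v (A *\<^sub>v (x - z))"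
      using B rc A x bz by (intro mult_minus_distrib_mat_vec mult_mat_vec_carrier) auto
    also have "\<dots> = ?B *\<^sub>v r - (x - z)"
      using inverse_mat_cancel(1)[OF A, of "x - z"] x bz by simp
    also have "\<dots> = ?B *\<^sub>v r + (z - x)"
      using B rc x bz by (intro eq_vecI) auto
    finally show ?thesis by simp
  qed
  ultimately show "l2_norm (?B *\<^sub>v r + (z - x))
      \<le> 4 * real n * u * demmel_cond A * (l2_norm (z - x) + l2_norm x)"
    using l2_norm_mult_mat_vec_le_op_norm[OF B \<delta>] by (simp add: demmel_cond_def E_def mult_ac)
qed

private lemma set_fp_refinement_rep:
  assumes b: "rep_vec F n b" and z: "z \<in> set_pmf (fp_refinement F A b K t)"
  shows "rep_vec F n z"
  using z
proof (induction t arbitrary: z)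
  case 0
  then show ?case using set_fp_kaczmarz_rep[OF b] by simp
next
  case (Suc t)
  then show ?case
    using fp_vec_add_error(1)[OF M] set_fp_kaczmarz_rep fp_residual_error(1)[OF b] u
    by (fastforce simp: less_imp_le)
qed

text \<open>
  Let \<open>y\<close> be the exact solution for the computed residual and \<open>\<eta> = 4 n u \<kappa>\<close>. The new error consists
  of \<open>y + (z - x)\<close>, at most \<open>\<eta> (\<parallel>z - x\<parallel> + \<parallel>x\<parallel>)\<close>, of the error \<open>d - y\<close> of the solve, on average at
  most \<open>\<parallel>y\<parallel> / 4\<close>, and of the rounding of the final addition. A quarter of \<open>\<parallel>z - x\<parallel>\<close>, inflated by
  these small terms, stays below a half.
\<close>

lemma fp_refinement_step_expected_error:
  assumes b: "rep_vec F n b" and z: "rep_vec F n z" and k: "real K \<ge> 12 * (demmel_cond A)\<^sup>2"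
  defines "x \<equiv> inverse_mat A *\<^sub>v b" and "r \<equiv> fp_vec_sub F b (fp_mult_mat_vec F A z)"
  shows "measure_pmf.expectation (fp_kaczmarz F A r K \<bind> (\<lambda>d. return_pmf (fp_vec_add F z d)))
      (\<lambda>y. l2_norm (y - x))
    \<le> l2_norm (z - x) / 2 + 8 * real n * u * demmel_cond A * l2_norm x"
proof -
  let ?y = "inverse_mat A *\<^sub>v r" and ?e = "l2_norm (z - x)" and ?X = "l2_norm x"
  define \<eta> where "\<eta> = 4 * real n * u * demmel_cond A"
  note r = fp_residual_error[OF b z, folded x_def r_def]
  have bz: "b \<in> carrier_vec n" "z \<in> carrier_vec n" "r \<in> carrier_vec n"
    using b z r(1) by (auto simp: rep_vec_def)
  have x: "x \<in> carrier_vec n" "?y \<in> carrier_vec n" using inverse_mat(1)[OF A] bz by (auto simp: x_def)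
  have y: "l2_norm ?y \<le> ?e + \<eta> * (?e + ?X)"
  proof -
    have "?y = (?y + (z - x)) + - (z - x)"
      using x bz carrier_matD[OF inverse_mat(1)[OF A]] by (intro eq_vecI) auto
    then show ?thesis
      using l2_norm_triangle[of "?y + (z - x)" n "- (z - x)"] r(2) x bz
      by (auto simp: \<eta>_def l2_norm_uminus)
  qed
  have u': "u \<le> 1 / 1000" using nu_bounds by linarith
  have \<eta>: "u \<le> \<eta> / 4" "\<eta> \<le> 1 / 250"
  proof -
    show "u \<le> \<eta> / 4"
      using mult_left_mono[OF cond_ge_1(1), of "real n * u"] nu_bounds by (simp add: \<eta>_def)
    have "demmel_cond A \<le> (demmel_cond A)\<^sup>2" using cond_ge_1 by (simp add: power2_eq_square)
    then have "1000 * real n * u * demmel_cond A \<le> 1"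
      using mult_left_mono[of _ _ "1000 * real n * u"] small u by fastforce
    then show "\<eta> \<le> 1 / 250" by (simp add: \<eta>_def)
  qed
  have fin: "finite (set_pmf (fp_kaczmarz F A r K))"
    by (rule finite_set_fp_kaczmarz[OF frobenius_nonzero])
  have "measure_pmf.expectation (fp_kaczmarz F A r K \<bind> (\<lambda>d. return_pmf (fp_vec_add F z d)))
      (\<lambda>y. l2_norm (y - x))
    \<le> (1 + u) * measure_pmf.expectation (fp_kaczmarz F A r K) (\<lambda>d. l2_norm (d - ?y))
      + ((1 + u) * (\<eta> * (?e + ?X)) + u * ?X)"
  proof (rule expectation_bind_affine_le[OF fin])
    fix d assume "d \<in> set_pmf (fp_kaczmarz F A r K)"
    then have d: "rep_vec F n d" by (rule set_fp_kaczmarz_rep[OF r(1)])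
    then have dc: "d \<in> carrier_vec n" by (simp add: rep_vec_def)
    let ?s = "fp_vec_add F z d" and ?w = "(z - x) + d"
    have s: "rep_vec F n ?s" "l2_norm (?s - (z + d)) \<le> u * l2_norm (z + d)"
      using fp_vec_add_error[OF M _ z d] u by auto
    have sc: "?s \<in> carrier_vec n" using s(1) by (simp add: rep_vec_def)
    have "?w = (?y + (z - x)) + (d - ?y)"
      using x bz dc carrier_matD[OF inverse_mat(1)[OF A]] by (intro eq_vecI) auto
    then have w: "l2_norm ?w \<le> \<eta> * (?e + ?X) + l2_norm (d - ?y)"
      using l2_norm_triangle[of "?y + (z - x)" n "d - ?y"] r(2) x bz dc by (auto simp: \<eta>_def)
    have "z + d = ?w + x" using x bz dc by (intro eq_vecI) auto
    then have "u * l2_norm (z + d) \<le> u * (l2_norm ?w + ?X)"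
      using l2_norm_triangle[of ?w n x] x bz dc u by (intro mult_left_mono) auto
    moreover have "?s - x = (?s - (z + d)) + ?w" using x bz dc sc by (intro eq_vecI) auto
    then have "l2_norm (?s - x) \<le> l2_norm (?s - (z + d)) + l2_norm ?w"
      using l2_norm_triangle[of "?s - (z + d)" n ?w] x bz dc sc by auto
    ultimately have "l2_norm (?s - x) \<le> (1 + u) * l2_norm ?w + u * ?X"
      using s(2) by (simp add: algebra_simps)
    also have "\<dots> \<le> (1 + u) * (\<eta> * (?e + ?X) + l2_norm (d - ?y)) + u * ?X"
      using w u by (intro add_right_mono mult_left_mono) auto
    finally show "measure_pmf.expectation (return_pmf ?s) (\<lambda>y. l2_norm (y - x))
      \<le> (1 + u) * l2_norm (d - ?y) + ((1 + u) * (\<eta> * (?e + ?X)) + u * ?X)"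
      by (simp add: algebra_simps)
  qed simp
  also have "\<dots> \<le> (1 + u) * (l2_norm ?y / 4) + ((1 + u) * (\<eta> * (?e + ?X)) + u * ?X)"
    using fp_kaczmarz_expected_error[OF r(1) k] u by (intro add_right_mono mult_left_mono) auto
  also have "\<dots> \<le> (1 + u) * ((?e + \<eta> * (?e + ?X)) / 4) + ((1 + u) * (\<eta> * (?e + ?X)) + u * ?X)"
    using y u by (intro add_right_mono mult_left_mono) auto
  also have "\<dots> = (1 + u) * (?e / 4 + 5 / 4 * (\<eta> * (?e + ?X))) + u * ?X"
    by (simp add: field_simps)
  \<comment> \<open>The factor 6/5 is a generous bound for \<open>1 + u\<close>: the coefficients of \<open>\<parallel>z - x\<parallel>\<close> then add up to
    \<open>3 / 10 + 3 / 2 \<eta>\<close>, and those of \<open>\<parallel>x\<parallel>\<close> to \<open>3 / 2 \<eta> + \<eta> / 4\<close>.\<close>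
  also have "\<dots> \<le> 6 / 5 * (?e / 4 + 5 / 4 * (\<eta> * (?e + ?X))) + \<eta> / 4 * ?X"
    using u u' \<eta> by (intro add_mono mult_right_mono) (auto intro!: add_nonneg_nonneg mult_nonneg_nonneg)
  also have "\<dots> \<le> ?e / 2 + 2 * (\<eta> * ?X)"
  proof -
    have "\<eta> * ?e \<le> 1 / 250 * ?e" using \<eta> by (intro mult_right_mono) auto
    moreover have "0 \<le> \<eta> * ?X" using \<eta> u by (intro mult_nonneg_nonneg) auto
    ultimately show ?thesis using l2_norm_nonneg[of "z - x"] unfolding distrib_left by linarith
  qed
  finally show ?thesis by (simp add: \<eta>_def)
qed

lemma fp_refinement_expected_error:
  assumes b: "rep_vec F n b" and k: "real K \<ge> 12 * (demmel_cond A)\<^sup>2"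
  defines "x \<equiv> inverse_mat A *\<^sub>v b"
  shows "measure_pmf.expectation (fp_refinement F A b K t) (\<lambda>y. l2_norm (y - x))
    \<le> (1 / 2) ^ t * l2_norm x + 16 * real n * u * demmel_cond A * l2_norm x"
proof -
  define L where "L = 16 * real n * u * demmel_cond A * l2_norm x"
  define s where "s t = measure_pmf.expectation (fp_refinement F A b K t) (\<lambda>y. l2_norm (y - x))" for t
  have L: "0 \<le> L" using u cond_ge_1 by (simp add: L_def)
  have "s (Suc t) \<le> 1 / 2 * s t + (1 - 1 / 2) * L" for t
    unfolding s_def fp_refinement.simps
  proof (rule expectation_bind_affine_le)
    show "finite (set_pmf (fp_refinement F A b K t))"
      by (rule finite_set_fp_refinement[OF frobenius_nonzero])
    fix z assume z: "z \<in> set_pmf (fp_refinement F A b K t)"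
    let ?p = "fp_kaczmarz F A (fp_vec_sub F b (fp_mult_mat_vec F A z)) K \<bind>
      (\<lambda>d. return_pmf (fp_vec_add F z d))"
    show "finite (set_pmf ?p)" using finite_set_fp_kaczmarz[OF frobenius_nonzero] by simp
    show "measure_pmf.expectation ?p (\<lambda>y. l2_norm (y - x)) \<le> 1 / 2 * l2_norm (z - x) + (1 - 1 / 2) * L"
      using fp_refinement_step_expected_error[OF b set_fp_refinement_rep[OF b z] k]
      by (simp add: x_def L_def mult_ac)
  qed
  then have "s t \<le> (1 / 2) ^ t * (s 0 - L) + L"
    by (intro affine_recursion_bound) auto
  also have "\<dots> \<le> (1 / 2) ^ t * l2_norm x + L"
  proof -
    have "s 0 \<le> l2_norm x / 4" using fp_kaczmarz_expected_error[OF b k] by (simp add: s_def x_def)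
    then have "s 0 - L \<le> l2_norm x" using L l2_norm_nonneg[of x] by linarith
    then show ?thesis by (intro add_right_mono mult_left_mono) auto
  qed
  finally show ?thesis by (simp add: s_def L_def)
qed

end

lemma half_power_ceiling_log_le:
  fixes \<epsilon> :: real
  assumes "0 < \<epsilon>"
  shows "(1 / 2) ^ nat \<lceil>log 2 (1 / \<epsilon>)\<rceil> \<le> \<epsilon>"
proof -
  let ?t = "nat \<lceil>log 2 (1 / \<epsilon>)\<rceil>"
  have "log 2 (1 / \<epsilon>) \<le> real ?t" by (rule real_nat_ceiling_ge)
  then have "1 / \<epsilon> \<le> 2 powr real ?t" using assms by (subst (asm) log_le_iff) auto
  then show ?thesis using assms by (simp add: powr_realpow field_simps)
qed



theorem theorem1p2:
  shows "\<exists>(c::real) (N::real \<Rightarrow> nat) (P::real poly) (Q::real poly).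
    c > 0 \<and> (\<forall>\<kappa>\<ge>1. real (N \<kappa>) \<le> c * \<kappa>\<^sup>2) \<and>
    (\<forall>n::nat. n \<ge> 1 \<longrightarrow> poly P (real n) > 0 \<and> poly Q (real n) > 0) \<and>
    (\<forall>(n::nat) (A::real mat) (b::real vec) (x::real vec) (u::real) (F::fp_arith) (t::nat).
      n \<ge> 1 \<longrightarrow>
      A \<in> carrier_mat n n \<longrightarrow> invertible_mat A \<longrightarrow>
      b \<in> carrier_vec n \<longrightarrow> x = inverse_mat A *\<^sub>v b \<longrightarrow>
      u > 0 \<longrightarrow> standard_model u F \<longrightarrow>
      (\<forall>i<n. \<forall>j<n. exactly_rep F (A $$ (i, j))) \<longrightarrow> (\<forall>i<n. exactly_rep F (b $ i)) \<longrightarrow>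
      t = nat \<lceil>log 2 (1 / (demmel_cond A * u))\<rceil> \<longrightarrow>
      (demmel_cond A)\<^sup>2 * u \<le> 1 / poly P (real n) \<longrightarrow>
      measure_pmf.expectation (fp_refinement F A b (N (demmel_cond A)) t)
          (\<lambda>x_hat. l2_norm (x_hat - x))
        \<le> poly Q (real n) * (l2_norm x * demmel_cond A * u))"
  \<comment> \<open>The ceiling of \<open>12 \<kappa>\<^sup>2\<close> is at most \<open>13 \<kappa>\<^sup>2\<close> because \<open>\<kappa> \<ge> 1\<close>; the factor 17 is 16 from
    the rounding errors of the refinements plus 1 from the choice of \<open>t\<close>; and any factor of at least
    \<open>576 = 8 \<cdot> 4 \<cdot> 18\<close> in place of 1000 brings the expected error of a single solve down to a quarter.\<close>
proof (rule exI[of _ 13], rule exI[of _ "\<lambda>\<kappa>. nat \<lceil>12 * \<kappa>\<^sup>2\<rceil>"],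
    rule exI[of _ "[:0, 1000:]"], rule exI[of _ "[:0, 17:]"], intro conjI allI impI)
  fix \<kappa> :: real
  assume "1 \<le> \<kappa>"
  then have "1 \<le> \<kappa>\<^sup>2" by simp
  then show "real (nat \<lceil>12 * \<kappa>\<^sup>2\<rceil>) \<le> 13 * \<kappa>\<^sup>2" by linarith
next
  fix n t :: nat and A :: "real mat" and b x :: "real vec" and u :: real and F :: fp_arith
  let ?K = "demmel_cond A"
  assume n: "n \<ge> 1" and A: "A \<in> carrier_mat n n" "invertible_mat A"
    and b: "b \<in> carrier_vec n" and x: "x = inverse_mat A *\<^sub>v b"
    and u: "u > 0" and M: "standard_model u F"
    and A_rep: "\<forall>i<n. \<forall>j<n. exactly_rep F (A $$ (i, j))" and b_rep: "\<forall>i<n. exactly_rep F (b $ i)"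
    and t: "t = nat \<lceil>log 2 (1 / (?K * u))\<rceil>"
    and small: "?K\<^sup>2 * u \<le> 1 / poly [:0, 1000:] (real n)"
  let ?E = "measure_pmf.expectation (fp_refinement F A b (nat \<lceil>12 * ?K\<^sup>2\<rceil>) t)
    (\<lambda>x_hat. l2_norm (x_hat - x))"
  have K: "1 \<le> ?K" by (rule op_norm_inverse_bounds(2)[OF A n])
  have rows: "rep_vec F n (row A i)" if "i < n" for i
    using A A_rep that by (auto simp: rep_vec_def)
  have "1000 * real n * u * ?K\<^sup>2 \<le> 1"
    using small n by (simp add: field_simps)
  from fp_refinement_expected_error[OF n A u M rows this, of b "nat \<lceil>12 * ?K\<^sup>2\<rceil>" t]
  have "?E \<le> (1 / 2) ^ t * l2_norm x + 16 * real n * u * ?K * l2_norm x"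
    using b b_rep by (simp add: rep_vec_def x real_nat_ceiling_ge)
  also have "(1 / 2) ^ t * l2_norm x \<le> ?K * u * l2_norm x"
    unfolding t using K u by (intro mult_right_mono half_power_ceiling_log_le) auto
  also have "\<dots> \<le> real n * (?K * u * l2_norm x)"
    using n K u mult_right_mono[of 1 "real n" "?K * u * l2_norm x"] by simp
  finally show "?E \<le> poly [:0, 17:] (real n) * (l2_norm x * ?K * u)"
    by (simp add: algebra_simps)
qed auto

end
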